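(* Let $r\geq 2$ be an integer, let $c=r^{-(r+7)(r+1)}$, let $n\geq e^{2/c}$ be an integer, and let $G$ be a graph of order $n$ with exactly $t_r(n)+1$ edges. Then $G$ contains a (not necessarily induced) subgraph isomorphic to $K_r^+\left(\lfloor c\ln n\rfloor,\ldots,\lfloor c\ln n\rfloor\right)$, i.e. with all $r$ parts of size $\lfloor c\ln n\rfloor$.
   Context: $t_r(n)$ denotes the number of edges of the $r$-partite Turán graph of order $n$ (the complete $r$-partite graph on $n$ vertices with part sizes as equal as possible). For integers $s_1\geq 2,s_2,\ldots,s_r\geq 1$, $K_r^+(s_1,\ldots,s_r)$ denotes the complete $r$-partite graph with parts of sizes $s_1,\ldots,s_r$ together with one additional edge joining two vertices of the first part (the part of size $s_1$). *)

theory Defs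
  imports Complex_Main
begin

type_synonym 'a graph = "'a set \<times> 'a set set"

abbreviation verts :: "'a graph \<Rightarrow> 'a set" where "verts \<equiv> fst"
abbreviation edges :: "'a graph \<Rightarrow> 'a set set" where "edges \<equiv> snd"

definition sgraph :: "'a graph \<Rightarrow> bool" where
  "sgraph G \<longleftrightarrow> finite (verts G) \<and> (\<forall>e\<in>edges G. e \<subseteq> verts G \<and> card e = 2)"

definition subgraph :: "'a graph \<Rightarrow> 'a graph \<Rightarrow> bool" where
  "subgraph H G \<longleftrightarrow> sgraph H \<and> verts H \<subseteq> verts G \<and> edges H \<subseteq> edges G"

definition isomorphic :: "'a graph \<Rightarrow> 'b graph \<Rightarrow> bool" where
  "isomorphic G H \<longleftrightarrow>
     (\<exists>f. bij_betw f (verts G) (verts H) \<and>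
          (\<forall>u\<in>verts G. \<forall>v\<in>verts G. {u, v} \<in> edges G \<longleftrightarrow> {f u, f v} \<in> edges H))"

text \<open>The vertex \<open>(i, j)\<close> is the \<open>j\<close>-th vertex of the \<open>i\<close>-th part, both counted from 0.\<close>

definition complete_multipartite :: "nat list \<Rightarrow> (nat \<times> nat) graph" where
  "complete_multipartite ss =
     (let V = {(i, j). i < length ss \<and> j < ss ! i}
      in (V, {{u, v} | u v. u \<in> V \<and> v \<in> V \<and> fst u \<noteq> fst v}))"

text \<open>Meaningful only if the first part has at least two vertices.\<close>

definition complete_multipartite_plus :: "nat list \<Rightarrow> (nat \<times> nat) graph" where
  "complete_multipartite_plus ss =
     (verts (complete_multipartite ss),
      insert {(0, 0), (0, 1)} (edges (complete_multipartite ss)))"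

definition turan_parts :: "nat \<Rightarrow> nat \<Rightarrow> nat list" where
  "turan_parts r n = map (\<lambda>i. n div r + (if i < n mod r then 1 else 0)) [0..<r]"

definition turan_graph :: "nat \<Rightarrow> nat \<Rightarrow> (nat \<times> nat) graph" where
  "turan_graph r n = complete_multipartite (turan_parts r n)"

definition turan_number :: "nat \<Rightarrow> nat \<Rightarrow> nat" where
  "turan_number r n = card (edges (turan_graph r n))"

lemma length_turan_parts: "length (turan_parts r n) = r"
  by (simp add: turan_parts_def)

lemma turan_parts_balanced:
  assumes "x \<in> set (turan_parts r n)" "y \<in> set (turan_parts r n)"
  shows "x \<le> y + 1"
  using assms by (auto simp: turan_parts_def)

lemma sum_list_turan_parts:
  assumes "r > 0"
  shows "sum_list (turan_parts r n) = n"
proof -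
  have "{i. i < r \<and> i < n mod r} = {..<n mod r}"
    using mod_less_divisor[OF assms, of n] by (auto simp del: mod_less_divisor)
  hence "(\<Sum>i<r. if i < n mod r then 1 else 0) = n mod r"
    by (simp add: sum.If_cases Int_def)
  hence "sum_list (turan_parts r n) = r * (n div r) + n mod r"
    by (simp add: turan_parts_def sum_list_addf sum_list_distinct_conv_sum_set
        atLeast0LessThan sum.distrib)
  thus ?thesis by simp
qed

lemma sgraph_complete_multipartite: "sgraph (complete_multipartite ss)"
proof -
  have "{(i, j). i < length ss \<and> j < ss ! i} = (SIGMA i:{..<length ss}. {..<ss ! i})"
    by auto
  hence "finite {(i, j). i < length ss \<and> j < ss ! i}" by simp
  thus ?thesis
    by (auto simp: sgraph_def complete_multipartite_def Let_def card_2_iff)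
qed

lemma sgraph_complete_multipartite_plus:
  assumes "ss \<noteq> []" "hd ss \<ge> 2"
  shows "sgraph (complete_multipartite_plus ss)"
  using sgraph_complete_multipartite[of ss] assms
  by (auto simp: sgraph_def complete_multipartite_plus_def complete_multipartite_def Let_def
      hd_conv_nth card_insert_if)

end

theory Submission
  imports Defs
begin

text \<open>
  Deleting vertices whose degree is below that of the Turan graph leaves a set \<open>W\<close> of at least
  \<open>sqrt n\<close> vertices which still spans more than \<open>t_r(|W|)\<close> edges and in which every vertex misses
  at most about \<open>|W|/r\<close> others. By Turan's theorem \<open>W\<close> contains a clique \<open>R\<close> on \<open>r + 1\<close> vertices.
  This clique is traded, one vertex at a time, for the parts of a complete multipartite graph: if
  \<open>R\<close> has at least three vertices and is joined to a complete \<open>k\<close>-partite graph with parts of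
  logarithmic size, consisting of disjoint \<open>k\<close>-cliques, then by the degree condition each of these
  \<open>k\<close>-cliques together with all but one vertex of \<open>R\<close> has many common neighbours, and by
  pigeonhole there are many vertices joined to the same \<open>1/(8r)\<close> of the \<open>k\<close>-cliques and to the
  same \<open>|R| - 1\<close> vertices of \<open>R\<close>; they form part \<open>k + 1\<close>. When \<open>R\<close> has shrunk to an edge, common
  neighbours of the \<open>(r-1)\<close>-cliques provide the last part, in which the edge \<open>R\<close> replaces two
  vertices. The part sizes lose only a factor \<open>(8r)^r\<close>, so no exponent of \<open>ln n\<close> is lost.
\<close>

section \<open>Edge numbers of Turan graphs\<close>

text \<open>Dealing the numbers below \<open>n\<close> round-robin into \<open>r\<close> parts puts
  \<open>k\<close> at position \<open>k div r\<close> of part \<open>k mod r\<close>. In this form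
  the Turan graphs of consecutive orders are nested.\<close>

lemma turan_graph_verts:
  assumes "r > 0"
  shows "verts (turan_graph r n) = (\<lambda>k. (k mod r, k div r)) ` {..<n}"
proof -
  have key: "j < n div r + (if i < n mod r then 1 else 0) \<longleftrightarrow> r * j + i < n" if "i < r" for i j
  proof -
    define q b where "q = n div r" and "b = n mod r"
    have b: "b < r" using assms by (simp add: b_def)
    have "j < q + (if i < b then 1 else 0) \<longleftrightarrow> r * j + i < r * q + b"
    proof (cases j q rule: linorder_cases)
      case less
      hence "r * Suc j \<le> r * q" by (intro mult_le_mono2) simp
      thus ?thesis using less that by simp
    next
      case greater
      hence "r * Suc q \<le> r * j" by (intro mult_le_mono2) simp
      thus ?thesis using greater b by simp
    qed simp
    thus ?thesis by (simp add: q_def b_def)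
  qed
  have "verts (turan_graph r n) = {(i, j). i < r \<and> r * j + i < n}"
    by (simp add: turan_graph_def complete_multipartite_def Let_def turan_parts_def key
        cong: conj_cong)
  also have "\<dots> = (\<lambda>k. (k mod r, k div r)) ` {..<n}"
  proof (rule set_eqI, clarify)
    fix i j
    show "(i, j) \<in> {(i, j). i < r \<and> r * j + i < n} \<longleftrightarrow>
        (i, j) \<in> (\<lambda>k. (k mod r, k div r)) ` {..<n}"
      using assms by (force intro!: image_eqI[where x = "r * j + i"])
  qed
  finally show ?thesis .
qed

lemma turan_graph_edges:
  "edges (turan_graph r n) =
    {{u, v} | u v. u \<in> verts (turan_graph r n) \<and> v \<in> verts (turan_graph r n) \<and> fst u \<noteq> fst v}"
  by (simp add: turan_graph_def complete_multipartite_def Let_def)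

text \<open>The added vertex enters part \<open>n mod r\<close>, which already holds
  \<open>n div r\<close> vertices, and is joined to all the others. This increment is the degree
  threshold in both deletion arguments below.\<close>

lemma turan_number_Suc:
  assumes "r > 0"
  shows "turan_number r (Suc n) = turan_number r n + (n - n div r)"
proof -
  define V where "V = verts (turan_graph r n)"
  define w where "w = (n mod r, n div r)"
  define N where "N = {v \<in> V. fst v \<noteq> n mod r}"
  have inj: "inj (\<lambda>k. (k mod r, k div r))"
    by (rule injI) (metis div_mult_mod_eq prod.inject)
  have V: "V = (\<lambda>k. (k mod r, k div r)) ` {..<n}"
    unfolding V_def by (rule turan_graph_verts[OF assms])
  have V': "verts (turan_graph r (Suc n)) = insert w V"
    unfolding V turan_graph_verts[OF assms] w_def by (simp add: lessThan_Suc)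
  have finV: "finite V" and cardV: "card V = n"
    unfolding V using card_image[OF inj_on_subset[OF inj subset_UNIV], of "{..<n}"] by auto
  have wV: "w \<notin> V"
    using inj_image_mem_iff[OF inj, of n "{..<n}"] by (simp add: V w_def)
  have NV: "N \<subseteq> V" by (auto simp: N_def)
  have "V - N = (\<lambda>j. (n mod r, j)) ` {..<n div r}"
  proof (rule set_eqI, clarify)
    fix i j
    have "(i, j) \<in> V \<longleftrightarrow> i < r \<and> r * j + i < n"
      unfolding V using assms by (force intro!: image_eqI[where x = "r * j + i"])
    moreover have "r * j + n mod r < n \<longleftrightarrow> j < n div r"
    proof -
      have "n = r * (n div r) + n mod r" by simp
      hence "r * j + n mod r < n \<longleftrightarrow> r * j < r * (n div r)" by linarith
      thus ?thesis using assms by simp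
    qed
    ultimately show "(i, j) \<in> V - N \<longleftrightarrow> (i, j) \<in> (\<lambda>j. (n mod r, j)) ` {..<n div r}"
      using assms by (auto simp: N_def)
  qed
  hence "card (V - N) = n div r"
    by (simp add: card_image inj_on_def)
  moreover have "card (V - N) = n - card N"
    using card_Diff_subset[of N V] finite_subset[OF NV finV] NV cardV by simp
  moreover have "card N \<le> n"
    using card_mono[OF finV NV] cardV by simp
  ultimately have cardN: "card N = n - n div r" by linarith
  have e: "edges (turan_graph r (Suc n)) = edges (turan_graph r n) \<union> (\<lambda>v. {w, v}) ` N"
  proof
    show "edges (turan_graph r (Suc n)) \<subseteq> edges (turan_graph r n) \<union> (\<lambda>v. {w, v}) ` N"
      unfolding turan_graph_edges V' V_def[symmetric] N_def
      by (auto simp: w_def insert_commute image_iff)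
    have "{w, v} \<in> edges (turan_graph r (Suc n))" if "v \<in> N" for v
      unfolding turan_graph_edges V'
      using that by (intro CollectI exI[of _ w] exI[of _ v]) (auto simp: N_def w_def)
    thus "edges (turan_graph r n) \<union> (\<lambda>v. {w, v}) ` N \<subseteq> edges (turan_graph r (Suc n))"
      unfolding turan_graph_edges V' V_def[symmetric] by blast
  qed
  have sub: "e \<subseteq> V" if "e \<in> edges (turan_graph r n)" for e
    using that unfolding turan_graph_edges V_def by auto
  have fin: "finite (edges (turan_graph r n))"
    by (rule finite_subset[of _ "Pow V"]) (use sub finV in auto)
  have "card (edges (turan_graph r (Suc n)))
      = card (edges (turan_graph r n)) + card ((\<lambda>v. {w, v}) ` N)"
    unfolding e using sub wV fin finV by (intro card_Un_disjoint) (auto simp: N_def)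
  also have "card ((\<lambda>v. {w, v}) ` N) = card N"
    by (intro card_image) (auto simp: inj_on_def doubleton_eq_iff)
  finally show ?thesis by (simp add: turan_number_def cardN)
qed

section \<open>Double counting and pigeonhole\<close>

lemma sum_degrees_swap:
  assumes "finite A" "finite B"
  shows "(\<Sum>x\<in>A. card {y \<in> B. P x y}) = (\<Sum>y\<in>B. card {x \<in> A. P x y})"
proof -
  have "(\<Sum>x\<in>A. card {y \<in> B. P x y}) = (\<Sum>x\<in>A. \<Sum>y\<in>B. if P x y then 1 else 0)"
    using assms by (simp add: sum.If_cases Int_def)
  also have "\<dots> = (\<Sum>y\<in>B. \<Sum>x\<in>A. if P x y then 1 else 0)" by (rule sum.swap)
  also have "\<dots> = (\<Sum>y\<in>B. card {x \<in> A. P x y})"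
    using assms by (simp add: sum.If_cases Int_def)
  finally show ?thesis .
qed

lemma large_fibre:
  assumes "finite A" "finite B" "f ` A \<subseteq> B" "card B * t \<le> card A" "A \<noteq> {}"
  shows "\<exists>b\<in>B. t \<le> card {x \<in> A. f x = b}"
proof (rule ccontr)
  assume neg: "\<not> ?thesis"
  have "B \<noteq> {}" using assms(3,5) by auto
  have "card A = (\<Sum>b\<in>B. card {x \<in> A. f x = b})"
    using card_UN_disjoint[of B "\<lambda>b. {x \<in> A. f x = b}"] assms
    by (subst card_UN_disjoint[symmetric]) (auto intro!: arg_cong[where f = card])
  also have "\<dots> < (\<Sum>b\<in>B. t)"
    using neg \<open>B \<noteq> {}\<close> assms by (intro sum_strict_mono) auto
  finally show False using assms(4) by simp
qed

text \<open>Counting each \<open>x\<close> with the set of indices it serves, instead of using an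
  averaged binomial coefficient, costs a factor \<open>2 ^ card I\<close>, harmless for \<open>card I = O(ln (card X))\<close>.\<close>

lemma dense_incidence_complete_bipartite:
  fixes A :: "'i \<Rightarrow> 'x set" and col :: "'x \<Rightarrow> 'c"
  assumes "finite I" "finite X" "finite C" "col ` X \<subseteq> C"
    and A: "\<And>a. a \<in> I \<Longrightarrow> A a \<subseteq> X" "\<And>a. a \<in> I \<Longrightarrow> card X \<le> p * card (A a)"
    and I: "card I = 2 * p * t" and p: "p > 0" and "t > 0" and "X \<noteq> {}"
    and big: "card C * 2 ^ card I * card I \<le> card X"
  shows "\<exists>J Y b. J \<subseteq> I \<and> card J = t \<and> Y \<subseteq> X \<and> card Y = t \<and>
    (\<forall>a\<in>J. Y \<subseteq> A a) \<and> (\<forall>x\<in>Y. col x = b)"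
proof -
  define d where "d x = card {a \<in> I. x \<in> A a}" for x
  define Y0 where "Y0 = {x \<in> X. t \<le> d x}"
  have finY0: "finite Y0" "Y0 \<subseteq> X" using assms by (auto simp: Y0_def)
  have X0: "card X > 0" using assms by (simp add: card_gt_0_iff)
  \<comment> \<open>Count the incidences between \<open>I\<close> and \<open>X\<close>. Elements
    outside \<open>Y0\<close> account for at most \<open>t * card X\<close> of them, half of the
    lower bound for the total, so \<open>Y0\<close> fills at least a \<open>1/(2 * p)\<close> share
    of \<open>X\<close>.\<close>
  have "2 * p * t * card X \<le> (\<Sum>a\<in>I. p * card (A a))"
    using sum_mono[of I "\<lambda>_. card X" "\<lambda>a. p * card (A a)"] A I by simp
  also have "\<dots> = p * (\<Sum>a\<in>I. card {x \<in> X. x \<in> A a})"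
    unfolding sum_distrib_left
    by (intro sum.cong refl arg_cong2[where f = "(*)"] arg_cong[where f = card]) (use A in auto)
  also have "\<dots> = p * (\<Sum>x\<in>X. d x)"
    unfolding d_def by (subst sum_degrees_swap) (use assms in auto)
  also have "(\<Sum>x\<in>X. d x) = (\<Sum>x\<in>Y0. d x) + (\<Sum>x\<in>X - Y0. d x)"
    using finY0 assms by (metis add.commute sum.subset_diff)
  also have "(\<Sum>x\<in>Y0. d x) \<le> (\<Sum>x\<in>Y0. card I)"
    unfolding d_def using assms by (intro sum_mono card_mono) auto
  also have "(\<Sum>x\<in>X - Y0. d x) \<le> card (X - Y0) * t"
    by (rule order_trans[OF sum_bounded_above[of _ _ t]]) (auto simp: Y0_def)
  also have "\<dots> \<le> card X * t"
    using assms(2) by (intro mult_le_mono1 card_mono) auto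
  finally have "2 * p * t * card X \<le> p * (card Y0 * card I + card X * t)"
    by simp
  hence "2 * t * card X \<le> card Y0 * card I + card X * t"
    using p by (simp add: mult.assoc)
  hence "t * card X \<le> t * (card Y0 * (2 * p))" unfolding I by (simp add: algebra_simps)
  hence Y0: "card X \<le> card Y0 * (2 * p)" using \<open>t > 0\<close> by simp
  have "Y0 \<noteq> {}" using Y0 X0 by auto
  have cB: "card (Pow I \<times> C) * t \<le> card Y0"
  proof -
    have "(card (Pow I \<times> C) * t) * (2 * p) = card C * 2 ^ card I * card I"
      using assms by (simp add: card_cartesian_product card_Pow I mult_ac)
    also have "\<dots> \<le> card Y0 * (2 * p)" using big Y0 by linarith
    finally show ?thesis using p by simp
  qed
  \<comment> \<open>Pigeonhole on the pair of index set and colour; elements of one fibre lie in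
    exactly the same sets \<open>A a\<close>.\<close>
  have "\<exists>b\<in>Pow I \<times> C. t \<le> card {x \<in> Y0. ({a \<in> I. x \<in> A a}, col x) = b}"
  proof (rule large_fibre)
    show "(\<lambda>x. ({a \<in> I. x \<in> A a}, col x)) ` Y0 \<subseteq> Pow I \<times> C"
      using \<open>col ` X \<subseteq> C\<close> \<open>Y0 \<subseteq> X\<close> by blast
  qed (use assms(1,3) finY0 cB \<open>Y0 \<noteq> {}\<close> in auto)
  then obtain J0 b where b: "J0 \<subseteq> I"
    "t \<le> card {x \<in> Y0. {a \<in> I. x \<in> A a} = J0 \<and> col x = b}" by auto
  then obtain Y where Y: "Y \<subseteq> {x \<in> Y0. {a \<in> I. x \<in> A a} = J0 \<and> col x = b}" "card Y = t"
    by (meson obtain_subset_with_card_n)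
  \<comment> \<open>For any such \<open>x\<close>, \<open>J0\<close> is the set counted by
    \<open>d x\<close>, so membership in \<open>Y0\<close> bounds its size from below.\<close>
  with \<open>t > 0\<close> obtain x where "x \<in> Y" by fastforce
  hence "t \<le> card J0" using Y by (auto simp: Y0_def d_def)
  then obtain J where J: "J \<subseteq> J0" "card J = t" by (meson obtain_subset_with_card_n)
  have "Y \<subseteq> A a" if "a \<in> J" for a using that J Y by auto
  moreover have "Y \<subseteq> X" using Y finY0 by auto
  ultimately show ?thesis using J Y b by (intro exI[of _ J] exI[of _ Y] exI[of _ b]) auto
qed

section \<open>Neighbourhoods and induced edges\<close>

locale edge_set =
  fixes E :: "'a set set"
  assumes card_edge: "e \<in> E \<Longrightarrow> card e = 2"
begin

definition nb :: "'a set \<Rightarrow> 'a \<Rightarrow> 'a set" where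
  "nb W v = {w \<in> W. {v, w} \<in> E}"

definition common_nb :: "'a set \<Rightarrow> 'a set \<Rightarrow> 'a set" where
  "common_nb W K = {w \<in> W. \<forall>v\<in>K. {v, w} \<in> E}"

definition induced :: "'a set \<Rightarrow> 'a set set" where
  "induced W = {e \<in> E. e \<subseteq> W}"

definition clique :: "'a set \<Rightarrow> bool" where
  "clique K \<longleftrightarrow> (\<forall>u\<in>K. \<forall>v\<in>K. u \<noteq> v \<longrightarrow> {u, v} \<in> E)"

lemma adj_neq: "{u, v} \<in> E \<Longrightarrow> u \<noteq> v"
  using card_edge[of "{u, v}"] by auto

lemma adj_commute: "{u, v} \<in> E \<longleftrightarrow> {v, u} \<in> E"
  by (simp add: insert_commute)

lemma finite_nb: "finite W \<Longrightarrow> finite (nb W v)"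
  by (simp add: nb_def)

lemma induced_empty: "induced {} = {}"
  using card_edge by (fastforce simp: induced_def)

lemma card_induced_insert:
  assumes "finite W" "v \<notin> W"
  shows "card (induced (insert v W)) = card (induced W) + card (nb (insert v W) v)"
proof -
  have "induced (insert v W) = induced W \<union> (\<lambda>w. {v, w}) ` nb (insert v W) v" (is "?L = ?R")
  proof
    show "?L \<subseteq> ?R"
    proof
      fix e assume e: "e \<in> ?L"
      show "e \<in> ?R"
      proof (cases "v \<in> e")
        case True
        moreover have "card e = 2" using e card_edge by (auto simp: induced_def)
        ultimately obtain w where "e = {v, w}"
          by (metis card_2_iff insertE singletonD insert_commute)
        thus ?thesis using e by (auto simp: induced_def nb_def)
      qed (use e in \<open>auto simp: induced_def\<close>)
    qed
  qed (auto simp: induced_def nb_def)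
  moreover have "finite (induced W)"
    using assms by (auto simp: induced_def intro: finite_subset[of _ "Pow W"])
  moreover have "finite ((\<lambda>w. {v, w}) ` nb (insert v W) v)"
    using assms by (simp add: finite_nb)
  moreover have "induced W \<inter> (\<lambda>w. {v, w}) ` nb (insert v W) v = {}"
    using assms by (auto simp: induced_def)
  moreover have "card ((\<lambda>w. {v, w}) ` nb (insert v W) v) = card (nb (insert v W) v)"
    by (intro card_image) (auto simp: inj_on_def doubleton_eq_iff)
  ultimately show ?thesis by (simp add: card_Un_disjoint)
qed

lemma card_induced_remove:
  assumes "finite W" "v \<in> W"
  shows "card (induced W) = card (induced (W - {v})) + card (nb W v)"
  using card_induced_insert[of "W - {v}" v] assms by (simp add: insert_absorb)

lemma card_nb_less:
  assumes "finite W" "v \<in> W"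
  shows "card (nb W v) < card W"
proof (rule psubset_card_mono)
  show "nb W v \<subset> W" using assms(2) adj_neq[of v v] unfolding nb_def by blast
qed fact

text \<open>Edges are at most as numerous as ordered pairs of distinct vertices. This crude bound is
  what stops the vertex deletions before the set gets too small.\<close>

lemma card_induced_le:
  assumes "finite W"
  shows "card (induced W) + card W \<le> card W * card W"
  using assms
proof (induction W rule: finite_induct)
  case (insert v W)
  have "card (nb (insert v W) v) \<le> card W"
    using card_nb_less[of "insert v W" v] insert by simp
  thus ?case using insert card_induced_insert[of W v] by simp
qed (simp add: induced_empty)

text \<open>Union bound: each vertex of \<open>K\<close> excludes at most \<open>q\<close> vertices
  of \<open>W\<close>.\<close>

lemma card_common_nb:
  assumes "finite W" "finite K" "\<And>v. v \<in> K \<Longrightarrow> card W \<le> card (nb W v) + q"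
  shows "card W \<le> card (common_nb W K) + card K * q"
proof -
  have "card (W - nb W v) \<le> q" if "v \<in> K" for v
    using assms(3)[OF that] assms(1) finite_nb[of W v]
    by (subst card_Diff_subset) (auto simp: nb_def)
  hence "(\<Sum>v\<in>K. card (W - nb W v)) \<le> card K * q"
    using sum_bounded_above[of K "\<lambda>v. card (W - nb W v)" q] by simp
  moreover have "card (\<Union>v\<in>K. W - nb W v) \<le> (\<Sum>v\<in>K. card (W - nb W v))"
    by (rule card_UN_le[OF assms(2)])
  moreover have "card W \<le> card (common_nb W K \<union> (\<Union>v\<in>K. W - nb W v))"
    using assms by (intro card_mono) (auto simp: common_nb_def nb_def)
  moreover have "card (common_nb W K \<union> (\<Union>v\<in>K. W - nb W v))
      \<le> card (common_nb W K) + card (\<Union>v\<in>K. W - nb W v)"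
    by (rule card_Un_le)
  ultimately show ?thesis by linarith
qed

section \<open>Cliques and dense subsets\<close>

text \<open>A clique on at most \<open>r\<close> vertices excludes at most
  \<open>r * q < card W\<close> vertices, so some common neighbour extends it; since there are no
  loops, that vertex is new.\<close>

lemma clique_greedy:
  assumes "finite W" "\<And>v. v \<in> W \<Longrightarrow> card W \<le> card (nb W v) + q" "r * q < card W" "k \<le> Suc r"
  shows "\<exists>K\<subseteq>W. card K = k \<and> clique K"
  using assms(4)
proof (induction k)
  case 0
  show ?case by (intro exI[of _ "{}"]) (simp add: clique_def)
next
  case (Suc k)
  then obtain K where K: "K \<subseteq> W" "card K = k" "clique K" by auto
  have finK: "finite K" using K assms(1) finite_subset by blast
  have "card W \<le> card (common_nb W K) + card K * q"
    using assms(1,2) K finK by (intro card_common_nb) auto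
  moreover have "card K * q \<le> r * q" using K Suc.prems by simp
  ultimately have "card (common_nb W K) \<noteq> 0" using assms(3) by linarith
  hence "common_nb W K \<noteq> {}" by auto
  then obtain w where w: "w \<in> W" "\<And>v. v \<in> K \<Longrightarrow> {v, w} \<in> E"
    by (auto simp: common_nb_def)
  hence "w \<notin> K" using adj_neq by blast
  thus ?case using K w finK
    by (intro exI[of _ "insert w K"]) (auto simp: clique_def adj_commute)
qed

text \<open>A vertex whose degree is at most the Turan increment can be deleted without losing the
  excess of edges. If there is none, every vertex misses at most \<open>k div r\<close> vertices,
  itself included, and the greedy construction succeeds.\<close>

lemma turan:
  assumes "finite W" "r > 0" "card (induced W) > turan_number r (card W)"
  shows "\<exists>K\<subseteq>W. card K = Suc r \<and> clique K"
  using assms(1,3)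
proof (induction "card W" arbitrary: W)
  case 0
  thus ?case by (simp add: induced_empty)
next
  case (Suc k)
  show ?case
  proof (cases "\<exists>v\<in>W. card (nb W v) \<le> k - k div r")
    case True
    then obtain v where v: "v \<in> W" "card (nb W v) \<le> k - k div r" by auto
    have "card (W - {v}) = k" using Suc v by simp
    moreover have "turan_number r (Suc k) < card (induced W)"
      using Suc.prems Suc.hyps(2) by simp
    hence "card (induced (W - {v})) > turan_number r k"
      using v card_induced_remove[OF Suc.prems(1) v(1)] turan_number_Suc[OF \<open>r > 0\<close>, of k]
      by linarith
    ultimately show ?thesis using Suc.hyps(1)[of "W - {v}"] Suc.prems by auto
  next
    case False
    have "card W \<le> card (nb W v) + k div r" if "v \<in> W" for v
    proof -
      have "k - k div r < card (nb W v)" using False that by auto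
      thus ?thesis using Suc.hyps(2) by linarith
    qed
    moreover have "r * (k div r) < card W"
      using Suc.hyps(2) times_div_less_eq_dividend[of r k] by linarith
    ultimately show ?thesis using Suc.prems by (intro clique_greedy) auto
  qed
qed

text \<open>Every deleted vertex raises the excess over the Turan number by one, and the excess
  cannot exceed the number of pairs that remain; hence the deletions stop at about
  \<open>sqrt N\<close> vertices at the latest.\<close>

lemma large_min_degree_subset:
  assumes "finite W" "r > 0" "card W \<le> N"
    and "card (induced W) + card W > turan_number r (card W) + N"
  shows "\<exists>U\<subseteq>W. N \<le> card U * card U \<and> turan_number r (card U) < card (induced U) \<and>
    (\<forall>v\<in>U. card U \<le> card (nb U v) + (card U div r + 1))"
  using assms(1,3,4)
proof (induction "card W" arbitrary: W)
  case 0
  thus ?case by (simp add: induced_empty)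
next
  case (Suc k)
  show ?case
  proof (cases "\<exists>v\<in>W. card (nb W v) < k - k div r")
    case True
    then obtain v where v: "v \<in> W" "card (nb W v) < k - k div r" by auto
    have c: "card (W - {v}) = k" using Suc v by simp
    moreover have "card (induced (W - {v})) + k > turan_number r k + N"
      using Suc.prems v card_induced_remove[OF Suc.prems(1) v(1)]
        turan_number_Suc[OF \<open>r > 0\<close>, of k] Suc.hyps(2)[symmetric] by simp
    ultimately obtain U where "U \<subseteq> W - {v}" "N \<le> card U * card U"
      "turan_number r (card U) < card (induced U)"
      "\<forall>v\<in>U. card U \<le> card (nb U v) + (card U div r + 1)"
      using Suc.hyps(1)[of "W - {v}"] Suc.prems Suc.hyps(2) by auto
    thus ?thesis by blast
  next
    case False
    have "card W \<le> card (nb W v) + (card W div r + 1)" if "v \<in> W" for v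
    proof -
      have "k - k div r \<le> card (nb W v)" using False that by auto
      moreover have "k div r \<le> card W div r" using Suc.hyps(2) by (intro div_le_mono) simp
      ultimately show ?thesis using Suc.hyps(2) by linarith
    qed
    \<comment> \<open>The excess hypothesis already forces more than \<open>N\<close> on the left of
      \<open>card_induced_le\<close>.\<close>
    moreover have "N \<le> card W * card W"
      using card_induced_le[OF Suc.prems(1)] Suc.prems by linarith
    ultimately show ?thesis using Suc.prems by (intro exI[of _ W]) auto
  qed
qed

section \<open>Trading clique vertices for parts\<close>

text \<open>Double counting of the edges between \<open>R\<close> and the common neighbours of
  \<open>K\<close>: a common neighbour outside \<open>A\<close> sees at most
  \<open>card R - 2\<close> vertices of \<open>R\<close>, one in \<open>A\<close> at most two more.
  The degree condition bounds the number of these edges from below.\<close>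

lemma card_almost_joined:
  assumes "finite W" "R \<subseteq> W" "card R \<ge> 2" "K \<subseteq> W"
    and "\<And>v. v \<in> W \<Longrightarrow> card W \<le> card (nb W v) + q"
  defines "A \<equiv> {x \<in> common_nb W K. card R - 1 \<le> card {v \<in> R. {v, x} \<in> E}}"
  shows "2 * card W \<le> 2 * card A + (2 * card K + card R) * q"
proof -
  let ?M = "common_nb W K"
  have fin: "finite R" "finite K" "finite ?M"
    using assms finite_subset by (auto simp: common_nb_def)
  obtain i where i: "card R = Suc (Suc i)" using assms(3)
    by (metis Suc_le_D numeral_2_eq_2 Suc_le_mono)
  have "card ?M \<le> card {x \<in> ?M. {v, x} \<in> E} + q" if "v \<in> R" for v
  proof -
    have "card ?M \<le> card ({x \<in> ?M. {v, x} \<in> E} \<union> (W - nb W v))"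
      using fin assms(1) by (intro card_mono) (auto simp: common_nb_def nb_def)
    also have "\<dots> \<le> card {x \<in> ?M. {v, x} \<in> E} + card (W - nb W v)" by (rule card_Un_le)
    also have "card (W - nb W v) \<le> q"
      using assms(5)[of v] that assms(1,2) finite_nb[of W v]
      by (subst card_Diff_subset) (auto simp: nb_def)
    finally show ?thesis by simp
  qed
  hence "card R * card ?M \<le> (\<Sum>v\<in>R. card {x \<in> ?M. {v, x} \<in> E} + q)"
    using sum_mono[of R "\<lambda>_. card ?M" "\<lambda>v. card {x \<in> ?M. {v, x} \<in> E} + q"] by simp
  also have "\<dots> = (\<Sum>x\<in>?M. card {v \<in> R. {v, x} \<in> E}) + card R * q"
    using sum_degrees_swap[OF fin(1) fin(3), of "\<lambda>v x. {v, x} \<in> E"] by (simp add: sum.distrib)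
  also have "(\<Sum>x\<in>?M. card {v \<in> R. {v, x} \<in> E}) \<le> (\<Sum>x\<in>?M. i + (if x \<in> A then 2 else 0))"
  proof (rule sum_mono)
    fix x assume "x \<in> ?M"
    moreover have "card {v \<in> R. {v, x} \<in> E} \<le> card R" using fin by (intro card_mono) auto
    ultimately show "card {v \<in> R. {v, x} \<in> E} \<le> i + (if x \<in> A then 2 else 0)"
      using i by (auto simp: A_def)
  qed
  also have "\<dots> = card ?M * i + card A * 2"
  proof -
    have "?M \<inter> {x. x \<in> A} = A" by (auto simp: A_def)
    thus ?thesis using fin by (simp add: sum.distrib sum.If_cases)
  qed
  finally have "2 * card ?M \<le> 2 * card A + card R * q" using i by (simp add: algebra_simps)
  moreover have "card W \<le> card ?M + card K * q"
    using assms fin by (intro card_common_nb) auto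
  ultimately show ?thesis by (simp add: algebra_simps)
qed

text \<open>The vertex \<open>\<phi> i a\<close> is the \<open>a\<close>-th vertex of the \<open>i\<close>-th part of a complete \<open>k\<close>-partite
  graph, all of which is joined to the clique \<open>R\<close>. Indexing all parts by the same set \<open>I\<close> singles
  out the disjoint \<open>k\<close>-cliques \<open>{\<phi> i a | i. i < k}\<close>.\<close>

definition joined_blowup :: "'a set \<Rightarrow> 'a set \<Rightarrow> nat \<Rightarrow> 'i set \<Rightarrow> (nat \<Rightarrow> 'i \<Rightarrow> 'a) \<Rightarrow> bool" where
  "joined_blowup W R k I \<phi> \<longleftrightarrow> R \<subseteq> W \<and> clique R \<and>
     (\<forall>i<k. inj_on (\<phi> i) I \<and> \<phi> i ` I \<subseteq> W \<and> (\<forall>a\<in>I. \<forall>v\<in>R. {v, \<phi> i a} \<in> E)) \<and>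
     (\<forall>i<k. \<forall>j<k. i \<noteq> j \<longrightarrow> (\<forall>a\<in>I. \<forall>b\<in>I. {\<phi> i a, \<phi> j b} \<in> E))"

lemma joined_blowup_restrict:
  assumes "joined_blowup W R k I \<phi>" "J \<subseteq> I" "\<And>i. i < k \<Longrightarrow> \<psi> i = \<phi> i"
  shows "joined_blowup W R k J \<psi>"
proof -
  have "inj_on (\<psi> i) J" if "i < k" for i
    using assms that inj_on_subset unfolding joined_blowup_def by metis
  moreover have "\<psi> i ` J \<subseteq> W \<and> (\<forall>a\<in>J. \<forall>v\<in>R. {v, \<psi> i a} \<in> E)" if "i < k" for i
  proof -
    have "\<phi> i ` I \<subseteq> W" "\<forall>a\<in>I. \<forall>v\<in>R. {v, \<phi> i a} \<in> E"
      using assms(1) that by (simp_all add: joined_blowup_def)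
    thus ?thesis using assms(2) unfolding assms(3)[OF that] by blast
  qed
  moreover have "{\<psi> i a, \<psi> j b} \<in> E" if "i < k" "j < k" "i \<noteq> j" "a \<in> J" "b \<in> J" for i j a b
  proof -
    have "\<forall>a\<in>I. \<forall>b\<in>I. {\<phi> i a, \<phi> j b} \<in> E"
      using assms(1) that by (simp add: joined_blowup_def)
    thus ?thesis
      using assms(2) that(4,5) unfolding assms(3)[OF that(1)] assms(3)[OF that(2)] by blast
  qed
  moreover have "R \<subseteq> W" "clique R" using assms(1) by (auto simp: joined_blowup_def)
  ultimately show ?thesis unfolding joined_blowup_def by simp
qed

text \<open>Any bijection from \<open>J\<close> onto \<open>Y\<close> can index the new part:
  \<open>Y\<close> is joined to the transversal of every index in \<open>J\<close>, hence to every
  vertex left in the old parts.\<close>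

lemma joined_blowup_extend:
  assumes blow: "joined_blowup W R k I \<phi>"
    and "J \<subseteq> I" "finite J" "Y \<subseteq> W" "finite Y" "card Y = card J" "R' \<subseteq> R"
    and Y: "\<And>a. a \<in> J \<Longrightarrow> Y \<subseteq> common_nb W ((\<lambda>i. \<phi> i a) ` {..<k})"
    and R': "\<And>x v. x \<in> Y \<Longrightarrow> v \<in> R' \<Longrightarrow> {v, x} \<in> E"
  shows "\<exists>\<psi>. joined_blowup W R' (Suc k) J \<psi> \<and> \<psi> k ` J = Y \<and> (\<forall>i<k. \<psi> i = \<phi> i)"
proof -
  obtain g where g: "bij_betw g J Y"
    using assms(3,5,6) by (metis bij_betw_iff_card)
  define \<psi> where "\<psi> = \<phi>(k := g)"
  have gY: "g a \<in> Y" if "a \<in> J" for a using g that by (auto simp: bij_betw_def)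
  have new: "{\<phi> i a, g b} \<in> E" if "i < k" "a \<in> J" "b \<in> J" for i a b
    using Y[OF that(2)] gY[OF that(3)] that(1) by (auto simp: common_nb_def)
  have "{\<psi> i a, \<psi> j b} \<in> E" if "i < Suc k" "j < Suc k" "i \<noteq> j" "a \<in> J" "b \<in> J" for i j a b
  proof (cases "i = k \<or> j = k")
    case True
    thus ?thesis using that new[of j b a] new[of i a b] by (auto simp: \<psi>_def insert_commute)
  next
    case False
    thus ?thesis using that blow \<open>J \<subseteq> I\<close>
      by (auto simp: \<psi>_def joined_blowup_def less_Suc_eq subset_iff)
  qed
  moreover have "inj_on (\<psi> i) J \<and> \<psi> i ` J \<subseteq> W \<and> (\<forall>a\<in>J. \<forall>v\<in>R'. {v, \<psi> i a} \<in> E)"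
    if "i < Suc k" for i
  proof (cases "i = k")
    case True
    thus ?thesis using g gY R' \<open>Y \<subseteq> W\<close> by (auto simp: \<psi>_def bij_betw_def)
  next
    case False
    hence "i < k" using that by simp
    hence i: "inj_on (\<phi> i) I" "\<phi> i ` I \<subseteq> W" "\<forall>a\<in>I. \<forall>v\<in>R. {v, \<phi> i a} \<in> E"
      using blow by (auto simp: joined_blowup_def)
    have "inj_on (\<phi> i) J" by (rule inj_on_subset[OF i(1) \<open>J \<subseteq> I\<close>])
    moreover have "\<phi> i ` J \<subseteq> W" using i(2) \<open>J \<subseteq> I\<close> by blast
    moreover have "\<forall>a\<in>J. \<forall>v\<in>R'. {v, \<phi> i a} \<in> E" using i(3) \<open>J \<subseteq> I\<close> \<open>R' \<subseteq> R\<close> by blast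
    ultimately show ?thesis using False by (simp add: \<psi>_def)
  qed
  moreover have "R \<subseteq> W" "clique R" using blow by (auto simp: joined_blowup_def)
  hence "R' \<subseteq> W" "clique R'" using \<open>R' \<subseteq> R\<close> unfolding clique_def by blast+
  moreover have "\<psi> k ` J = Y" using g by (simp add: \<psi>_def bij_betw_def)
  moreover have "\<forall>i<k. \<psi> i = \<phi> i" by (simp add: \<psi>_def)
  ultimately show ?thesis unfolding joined_blowup_def by blast
qed

text \<open>Dropping one vertex of \<open>R\<close> while adding a part: averaging over the degrees into \<open>R\<close> of the
  common neighbours of a transversal shows that a fixed proportion of all vertices is joined to
  the transversal and to all but one vertex of \<open>R\<close>. This needs \<open>card R \<ge> 3\<close>.\<close>

lemma joined_blowup_step:
  assumes blow: "joined_blowup W R k I \<phi>" and "finite W" "finite I"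
    and R: "card R + k = Suc r" "card R \<ge> 3"
    and deg: "\<And>v. v \<in> W \<Longrightarrow> card W \<le> card (nb W v) + (card W div r + 1)"
    and I: "card I = 8 * r * t" and "t > 0" "r > 0"
    and big: "2 ^ Suc r * 2 ^ card I * card I \<le> card W" "4 * r * r \<le> card W"
  shows "\<exists>R' J \<psi>. joined_blowup W R' (Suc k) J \<psi> \<and> card R' + Suc k = Suc r \<and>
    J \<subseteq> I \<and> card J = t"
proof -
  define K where "K a = (\<lambda>i. \<phi> i a) ` {..<k}" for a
  define A where "A a = {x \<in> common_nb W (K a). card R - 1 \<le> card {v \<in> R. {v, x} \<in> E}}" for a
  define q where "q = card W div r + 1"
  have "R \<subseteq> W" using blow by (simp add: joined_blowup_def)
  hence "finite R" using \<open>finite W\<close> finite_subset by blast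
  have q: "r * q \<le> card W + r" by (simp add: q_def algebra_simps)
  have W0: "W \<noteq> {}" using R \<open>R \<subseteq> W\<close> by auto
  have A: "card W \<le> (4 * r) * card (A a)" if "a \<in> I" for a
  proof -
    have "K a \<subseteq> W" using blow that by (auto simp: K_def joined_blowup_def)
    hence "2 * card W \<le> 2 * card (A a) + (2 * card (K a) + card R) * q"
      unfolding A_def q_def using assms(2) \<open>R \<subseteq> W\<close> R deg by (intro card_almost_joined) auto
    \<comment> \<open>The left side is at most \<open>r + 1 + k\<close>, and
      \<open>card R \<ge> 3\<close> means \<open>k \<le> r - 2\<close>. With \<open>q\<close> about
      \<open>card W / r\<close>, a coefficient below \<open>2 * r\<close> leaves a positive share
      for \<open>A a\<close>.\<close>
    moreover have "2 * card (K a) + card R \<le> 2 * r - 1"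
      using R card_image_le[of "{..<k}" "\<lambda>i. \<phi> i a"] by (simp add: K_def)
    ultimately have "2 * card W \<le> 2 * card (A a) + (2 * r - 1) * q"
      by (meson add_left_mono le_trans mult_le_mono1)
    hence "r * (2 * card W) \<le> r * (2 * card (A a) + (2 * r - 1) * q)"
      by (rule mult_le_mono2)
    also have "\<dots> = 2 * r * card (A a) + (2 * r - 1) * (r * q)" by (simp add: algebra_simps)
    also have "\<dots> \<le> 2 * r * card (A a) + (2 * r - 1) * (card W + r)"
      by (intro add_left_mono mult_le_mono2 q)
    finally have "card W + (2 * r - 1) * card W
        \<le> 2 * r * card (A a) + (2 * r - 1) * card W + (2 * r - 1) * r"
      using \<open>r > 0\<close> by (cases r) (simp_all add: algebra_simps)
    moreover have "(2 * r - 1) * r \<le> 2 * r * r" by (intro mult_le_mono1) simp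
    ultimately show ?thesis using big(2) by linarith
  qed
  \<comment> \<open>Colouring each vertex by its neighbourhood in \<open>R\<close> makes all of
    \<open>Y\<close> see the same set \<open>b\<close>, which has at least \<open>card R - 1\<close>
    elements because \<open>Y\<close> meets some \<open>A a\<close>.\<close>
  have "\<exists>J Y b. J \<subseteq> I \<and> card J = t \<and> Y \<subseteq> W \<and> card Y = t \<and>
    (\<forall>a\<in>J. Y \<subseteq> A a) \<and> (\<forall>x\<in>Y. {v \<in> R. {v, x} \<in> E} = b)"
  proof (rule dense_incidence_complete_bipartite[where p = "4 * r"])
    show "card (Pow R) * 2 ^ card I * card I \<le> card W"
    proof -
      have "card (Pow R) \<le> 2 ^ Suc r" using R \<open>finite R\<close> by (simp add: card_Pow del: power_Suc)
      hence "card (Pow R) * 2 ^ card I * card I \<le> 2 ^ Suc r * 2 ^ card I * card I"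
        by (intro mult_le_mono1)
      thus ?thesis using big(1) by linarith
    qed
    show "A a \<subseteq> W" for a by (auto simp: A_def common_nb_def)
  qed (use assms(2,3) \<open>finite R\<close> A I \<open>t > 0\<close> \<open>r > 0\<close> W0 in auto)
  then obtain J Y b where J: "J \<subseteq> I" "card J = t" and Y: "Y \<subseteq> W" "card Y = t"
    and YA: "\<forall>a\<in>J. Y \<subseteq> A a" and Yb: "\<forall>x\<in>Y. {v \<in> R. {v, x} \<in> E} = b"
    by (elim exE conjE)
  have fin: "finite J" "finite Y" using J(1) Y(1) assms(2,3) finite_subset by blast+
  have "Y \<noteq> {}" "J \<noteq> {}" using J(2) Y(2) \<open>t > 0\<close> by auto
  then obtain x a where xa: "x \<in> Y" "a \<in> J" by blast
  hence x: "x \<in> A a" "{v \<in> R. {v, x} \<in> E} = b" using YA Yb by auto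
  hence b: "card R - 1 \<le> card b" "b \<subseteq> R" by (auto simp: A_def)
  then obtain R' where R': "R' \<subseteq> b" "card R' = card R - 1" by (meson obtain_subset_with_card_n)
  have "\<exists>\<psi>. joined_blowup W R' (Suc k) J \<psi> \<and> \<psi> k ` J = Y \<and> (\<forall>i<k. \<psi> i = \<phi> i)"
  proof (rule joined_blowup_extend[OF blow])
    show "Y \<subseteq> common_nb W ((\<lambda>i. \<phi> i a) ` {..<k})" if "a \<in> J" for a
      using bspec[OF YA that] unfolding A_def K_def by blast
    show "{v, x} \<in> E" if "x \<in> Y" "v \<in> R'" for x v
      using bspec[OF Yb that(1)] that(2) R'(1) by blast
  qed (use J Y fin R' b in auto)
  moreover have "card R' + Suc k = Suc r" using R R'(2) by simp
  ultimately show ?thesis using J by blast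
qed

text \<open>After \<open>r - 1\<close> trades the clique is an edge \<open>{u, v}\<close>. The last
  part is taken among common neighbours of transversals and need not be joined to \<open>u\<close>
  and \<open>v\<close>; it only has to avoid them, so that they can later stand in for two of its
  vertices.\<close>

lemma blowup_joined_to_edge:
  assumes "finite W" "r \<ge> 2" "turan_number r (card W) < card (induced W)"
    and deg: "\<forall>v\<in>W. card W \<le> card (nb W v) + (card W div r + 1)"
    and "s > 0" and big: "8 ^ ((8 * r) ^ r * s) \<le> card W"
  shows "\<exists>u v I \<phi>. u \<noteq> v \<and> joined_blowup W {u, v} (r - 1) (I :: nat set) \<phi> \<and>
    joined_blowup W {} r I \<phi> \<and> card I = s \<and> u \<notin> \<phi> (r - 1) ` I \<and> v \<notin> \<phi> (r - 1) ` I"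
proof -
  define S where "S = (8 * r) ^ r * s"
  have S1: "(8 * r) ^ (r - k) * s \<le> S" for k
    unfolding S_def using assms(2) by (intro mult_le_mono1 power_increasing) auto
  have "(8 * r) ^ 2 \<le> (8 * r) ^ r" using assms(2) by (intro power_increasing) auto
  also have "\<dots> \<le> S" using \<open>s > 0\<close> by (simp add: S_def)
  finally have S2: "64 * r * r \<le> S" by (simp add: power2_eq_square)
  have S3: "Suc r \<le> S"
    using S2 assms(2) mult_le_mono1[of 2 r r] by linarith
  have S4: "S \<le> 2 ^ S" using less_exp[of S] by simp
  \<comment> \<open>The three factors of \<open>8 ^ S\<close> pay for the colours, the subsets of
    the index set and the size of the index set.\<close>
  have big': "2 ^ S * 2 ^ S * 2 ^ S \<le> card W"
    using big unfolding S_def[symmetric] by (simp flip: power_mult_distrib)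
  have big1: "2 ^ Suc r * 2 ^ x * x \<le> card W" if "x \<le> S" for x
  proof -
    have "2 ^ Suc r * 2 ^ x * x \<le> 2 ^ S * 2 ^ S * 2 ^ S"
      using that S3 order_trans[OF that S4] by (intro mult_le_mono power_increasing) auto
    thus ?thesis using big' by linarith
  qed
  have "1 * 1 * 2 ^ S \<le> 2 ^ S * 2 ^ S * (2::nat) ^ S" by (intro mult_le_mono) auto
  hence big2: "64 * r * r \<le> card W" using S2 S4 big' by linarith
  have W0: "W \<noteq> {}" using big2 assms(2) by auto
  \<comment> \<open>Every trade divides the index set by \<open>8 * r\<close>. It starts with
    \<open>S\<close> elements, where there are no parts yet to constrain it, and keeps one factor
    \<open>8 * r\<close> for the last part.\<close>
  have "\<exists>R I \<phi>. joined_blowup W R k (I :: nat set) \<phi> \<and> card R + k = Suc r \<and>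
      finite I \<and> card I = (8 * r) ^ (r - k) * s" if "k \<le> r - 1" for k
    using that
  proof (induction k)
    case 0
    obtain R where "R \<subseteq> W" "card R = Suc r" "clique R"
      using turan[of W r] assms by auto
    thus ?case by (intro exI[of _ R] exI[of _ "{..<S}"]) (simp add: joined_blowup_def S_def)
  next
    case (Suc k)
    then obtain R I \<phi> where blow: "joined_blowup W R k (I :: nat set) \<phi>" and R: "card R + k = Suc r"
      and I: "finite I" "card I = (8 * r) ^ (r - k) * s" by auto
    have "card R \<ge> 3" using R Suc.prems assms(2) by linarith
    have "r - k = Suc (r - Suc k)" using Suc.prems assms(2) by simp
    hence "card I = 8 * r * ((8 * r) ^ (r - Suc k) * s)" using I(2) by (simp add: mult_ac)
    hence "\<exists>R' J \<psi>. joined_blowup W R' (Suc k) J \<psi> \<and> card R' + Suc k = Suc r \<and>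
        J \<subseteq> I \<and> card J = (8 * r) ^ (r - Suc k) * s"
      using assms(1,2,5) R \<open>card R \<ge> 3\<close> I deg big1[of "card I"] big2 S1[of k]
      by (intro joined_blowup_step[OF blow]) auto
    thus ?case using I(1) finite_subset by blast
  qed
  from this[of "r - 1"] obtain R I \<phi> where blow: "joined_blowup W R (r - 1) (I :: nat set) \<phi>"
    and "card R + (r - 1) = Suc r" and "finite I" and "card I = (8 * r) ^ (r - (r - 1)) * s" by auto
  hence "card R = 2" and I: "card I = 8 * r * s" using assms(2) by (auto simp: Suc_diff_le)
  then obtain u v where R: "R = {u, v}" "u \<noteq> v" by (meson card_2_iff)
  define K where "K a = (\<lambda>i. \<phi> i a) ` {..<r - 1}" for a
  define A where "A a = common_nb W (K a) - {u, v}" for a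
  define q where "q = card W div r + 1"
  have q: "r * q \<le> card W + r" by (simp add: q_def algebra_simps)
  have A: "card W \<le> (4 * r) * card (A a)" if "a \<in> I" for a
  proof -
    have "K a \<subseteq> W" using blow that by (auto simp: K_def joined_blowup_def)
    hence "card W \<le> card (common_nb W (K a)) + card (K a) * q"
      unfolding q_def using assms(1) deg by (intro card_common_nb) (auto simp: K_def)
    moreover have "card (common_nb W (K a)) - 2 \<le> card (A a)"
      unfolding A_def using diff_card_le_card_Diff[of "{u, v}" "common_nb W (K a)"] R(2) by simp
    moreover have "card (K a) * q \<le> (r - 1) * q"
      using card_image_le[of "{..<r - 1}" "\<lambda>i. \<phi> i a"] by (intro mult_le_mono1) (simp add: K_def)
    ultimately have "card W \<le> card (A a) + 2 + (r - 1) * q" by linarith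
    hence "r * card W \<le> r * (card (A a) + 2 + (r - 1) * q)" by (rule mult_le_mono2)
    also have "\<dots> = r * card (A a) + 2 * r + (r - 1) * (r * q)"
      by (simp add: distrib_left mult_ac)
    also have "\<dots> \<le> r * card (A a) + 2 * r + (r - 1) * (card W + r)"
      by (intro add_left_mono mult_le_mono2 q)
    finally have "card W + (r - 1) * card W
        \<le> r * card (A a) + 2 * r + (r - 1) * card W + (r - 1) * r"
      using assms(2) by (cases r) (simp_all add: algebra_simps)
    moreover have "(r - 1) * r \<le> r * r" by (intro mult_le_mono1) simp
    moreover have "2 * r \<le> r * r" using assms(2) by simp
    ultimately show ?thesis using big2 by linarith
  qed
  \<comment> \<open>No neighbourhood in \<open>R\<close> has to be fixed this time, so a single
    colour suffices.\<close>
  have "\<exists>J Y (b::unit). J \<subseteq> I \<and> card J = s \<and> Y \<subseteq> W \<and> card Y = s \<and>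
    (\<forall>a\<in>J. Y \<subseteq> A a) \<and> (\<forall>x\<in>Y. () = b)"
  proof (rule dense_incidence_complete_bipartite[where p = "4 * r"])
    have "card I \<le> S" using S1[of "r - 1"] I assms(2) by (simp add: Suc_diff_le)
    hence "2 ^ Suc r * 2 ^ card I * card I \<le> card W" by (rule big1)
    moreover have "1 * 2 ^ card I * card I \<le> 2 ^ Suc r * 2 ^ card I * card I"
      by (intro mult_le_mono1) simp
    ultimately have "1 * 2 ^ card I * card I \<le> card W" by (rule order_trans[rotated])
    thus "card {()} * 2 ^ card I * card I \<le> card W" by simp
    show "A a \<subseteq> W" for a by (auto simp: A_def common_nb_def)
  qed (use assms(1,2,5) \<open>finite I\<close> A I W0 in auto)
  then obtain J Y where J: "J \<subseteq> I" "card J = s" and Y: "Y \<subseteq> W" "card Y = s"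
    and YA: "\<forall>a\<in>J. Y \<subseteq> A a" by (elim exE conjE)
  have fin: "finite J" "finite Y"
    using J(1) Y(1) assms(1) \<open>finite I\<close> finite_subset by blast+
  have "\<exists>\<psi>. joined_blowup W {} (Suc (r - 1)) J \<psi> \<and> \<psi> (r - 1) ` J = Y \<and> (\<forall>i<r-1. \<psi> i = \<phi> i)"
  proof (rule joined_blowup_extend[OF blow])
    show "Y \<subseteq> common_nb W ((\<lambda>i. \<phi> i a) ` {..<r - 1})" if "a \<in> J" for a
      using bspec[OF YA that] unfolding A_def K_def by blast
  qed (use J Y fin in auto)
  then obtain \<psi> where psi: "joined_blowup W {} r J \<psi>" "\<psi> (r - 1) ` J = Y"
    "\<And>i. i < r - 1 \<Longrightarrow> \<psi> i = \<phi> i" using assms(2) by auto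
  have b1: "joined_blowup W {u, v} (r - 1) J \<psi>"
    by (rule joined_blowup_restrict[OF blow[unfolded R] J(1) psi(3)])
  have "J \<noteq> {}" using J(2) \<open>s > 0\<close> by auto
  then obtain a where "a \<in> J" by blast
  hence "u \<notin> \<psi> (r - 1) ` J" "v \<notin> \<psi> (r - 1) ` J" using YA unfolding psi(2) A_def by blast+
  thus ?thesis using R(2) b1 psi(1) J(2)
    by (intro exI[of _ u] exI[of _ v] exI[of _ J] exI[of _ \<psi>] conjI)
qed

section \<open>Embedding the target graph\<close>

lemma complete_multipartite_plus_embedding:
  assumes "finite W" "r \<ge> 2" "turan_number r (card W) < card (induced W)"
    and deg: "\<forall>v\<in>W. card W \<le> card (nb W v) + (card W div r + 1)"
    and "s \<ge> 2" and big: "8 ^ ((8 * r) ^ r * s) \<le> card W"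
  defines "K \<equiv> complete_multipartite_plus (replicate r s)"
  shows "\<exists>f. inj_on f (verts K) \<and> f ` verts K \<subseteq> W \<and> (\<forall>e\<in>edges K. f ` e \<in> E)"
proof -
  have "s > 0" using \<open>s \<ge> 2\<close> by simp
  obtain u v I \<phi> where uv: "u \<noteq> v" and b1: "joined_blowup W {u, v} (r - 1) (I :: nat set) \<phi>"
    and b2: "joined_blowup W {} r I \<phi>" and I: "card I = s"
    and notin: "u \<notin> \<phi> (r - 1) ` I" "v \<notin> \<phi> (r - 1) ` I"
    using blowup_joined_to_edge[OF assms(1-4) \<open>s > 0\<close> big] by blast
  have "finite I" using I \<open>s > 0\<close> card_gt_0_iff by blast
  then obtain h where "bij_betw h {..<s} I"
    using I by (metis bij_betw_iff_card card_lessThan finite_lessThan)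
  hence h: "\<And>j. j < s \<Longrightarrow> h j \<in> I" "\<And>i j. i < s \<Longrightarrow> j < s \<Longrightarrow> h i = h j \<Longrightarrow> i = j"
    by (auto simp: bij_betw_def inj_on_def)
  \<comment> \<open>Part 0 of \<open>K\<close> goes to the last part of the blow-up, with
    \<open>u\<close> and \<open>v\<close> in place of its first two vertices; the other parts are
    shifted down by one.\<close>
  define f where "f = (\<lambda>(i, j). if i = 0 then if j = 0 then u else if j = 1 then v
      else \<phi> (r - 1) (h j) else \<phi> (i - 1) (h j))"
  have V: "verts K = {(i, j). i < r \<and> j < s}"
    by (auto simp: K_def complete_multipartite_plus_def complete_multipartite_def Let_def)
  have adj0: "{f (i, j), f (i', j')} \<in> E"
    if "i < r" "j < s" "i' < r" "j' < s" "i \<noteq> i'" "i' \<noteq> 0" for i j i' j'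
  proof (cases "i = 0")
    case True
    have "i' - 1 < r - 1" "i' - 1 < r" "r - 1 < r" "i' - 1 \<noteq> r - 1" using that by auto
    hence "{u, \<phi> (i' - 1) (h j')} \<in> E" "{v, \<phi> (i' - 1) (h j')} \<in> E"
      "{\<phi> (r - 1) (h j), \<phi> (i' - 1) (h j')} \<in> E"
      using b1 b2 h(1)[OF that(2)] h(1)[OF that(4)] unfolding joined_blowup_def by auto
    thus ?thesis using True that by (simp add: f_def)
  next
    case False
    have "i - 1 < r" "i' - 1 < r" "i - 1 \<noteq> i' - 1" using that False by auto
    hence "{\<phi> (i - 1) (h j), \<phi> (i' - 1) (h j')} \<in> E"
      using b2 h(1)[OF that(2)] h(1)[OF that(4)] unfolding joined_blowup_def by auto
    thus ?thesis using False that by (simp add: f_def)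
  qed
  have adj: "{f x, f y} \<in> E" if xy: "x \<in> verts K" "y \<in> verts K" "fst x \<noteq> fst y" for x y
  proof (cases "fst y = 0")
    case True
    thus ?thesis using adj0[of "fst y" "snd y" "fst x" "snd x"] xy
      by (auto simp: V insert_commute)
  next
    case False
    thus ?thesis using adj0[of "fst x" "snd x" "fst y" "snd y"] xy by (auto simp: V)
  qed
  have \<phi>: "inj_on (\<phi> i) I" "\<phi> i ` I \<subseteq> W" if "i < r" for i
    using b2 that by (auto simp: joined_blowup_def)
  have \<phi>_eq: "j = j'" if "\<phi> i (h j) = \<phi> i (h j')" "i < r" "j < s" "j' < s" for i j j'
    using h inj_onD[OF \<phi>(1)[OF that(2)] that(1)] that by blast
  have notin': "\<phi> (r - 1) (h j) \<noteq> u" "\<phi> (r - 1) (h j) \<noteq> v" if "j < s" for j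
    using notin h(1)[OF that] by auto
  have "inj_on f (verts K)"
  proof (rule inj_onI)
    fix x y assume xy: "x \<in> verts K" "y \<in> verts K" "f x = f y"
    \<comment> \<open>Vertices in different parts have adjacent images, which are distinct as there
      are no loops.\<close>
    hence "fst x = fst y" using adj[of x y] adj_neq by metis
    moreover obtain i j j' where ij: "x = (i, j)" "y = (fst x, j')" "i < r" "j < s" "j' < s"
      using xy calculation by (auto simp: V)
    have "j = j'"
    proof (cases "i = 0")
      case True
      thus ?thesis using xy(3) ij uv notin'[of j] notin'[of j'] \<phi>_eq[of "r - 1" j j'] assms(2)
        by (auto simp: f_def split: if_splits)
    next
      case False
      thus ?thesis using xy(3) ij \<phi>_eq[of "i - 1" j j'] by (auto simp: f_def)
    qed
    thus "x = y" using ij by simp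
  qed
  moreover have "f ` verts K \<subseteq> W"
  proof -
    have "u \<in> W" "v \<in> W" using b1 by (auto simp: joined_blowup_def)
    moreover have "\<phi> i (h j) \<in> W" if "i < r" "j < s" for i j using \<phi>(2) h(1) that by blast
    ultimately show ?thesis using assms(2) by (auto simp: V f_def)
  qed
  moreover have "f ` e \<in> E" if "e \<in> edges K" for e
  proof (cases "e = {(0, 0), (0, 1)}")
    case True
    have "{u, v} \<in> E" using b1 uv by (auto simp: joined_blowup_def clique_def)
    thus ?thesis using True by (simp add: f_def)
  next
    case False
    moreover have "edges K = insert {(0, 0), (0, 1)}
        {{x, y} | x y. x \<in> verts K \<and> y \<in> verts K \<and> fst x \<noteq> fst y}"
      by (simp add: K_def complete_multipartite_plus_def complete_multipartite_def Let_def)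
    ultimately have "e \<in> {{x, y} | x y. x \<in> verts K \<and> y \<in> verts K \<and> fst x \<noteq> fst y}"
      using that by simp
    then obtain x y where "e = {x, y}" "x \<in> verts K" "y \<in> verts K" "fst x \<noteq> fst y"
      by (elim CollectE exE conjE)
    thus ?thesis using adj by simp
  qed
  ultimately show ?thesis by blast
qed

end

lemma subgraph_of_embedding:
  assumes "sgraph K" "inj_on f (verts K)" "f ` verts K \<subseteq> verts G"
    and "\<forall>e\<in>edges K. f ` e \<in> edges G"
  shows "\<exists>H. subgraph H G \<and> isomorphic H K"
proof -
  define H where "H = (f ` verts K, (`) f ` edges K)"
  have K: "finite (verts K)" "e \<subseteq> verts K" "card e = 2" if "e \<in> edges K" for e
    using assms(1) that by (auto simp: sgraph_def)
  have "sgraph H"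
    unfolding sgraph_def H_def
  proof (intro conjI ballI)
    fix e assume "e \<in> edges (f ` verts K, (`) f ` edges K)"
    then obtain d where d: "d \<in> edges K" "e = f ` d" by auto
    show "e \<subseteq> verts (f ` verts K, (`) f ` edges K)" using K[OF d(1)] d by auto
    show "card e = 2"
      using K[OF d(1)] d card_image[OF inj_on_subset[OF assms(2)], of d] by simp
  qed (use assms(1) in \<open>simp add: sgraph_def\<close>)
  hence "subgraph H G" using assms(3,4) by (auto simp: subgraph_def H_def)
  moreover have "isomorphic H K"
    unfolding isomorphic_def
  \<comment> \<open>The witness is the inverse of \<open>f\<close>, since an isomorphism maps from
    its first graph to its second.\<close>
  proof (intro exI[of _ "inv_into (verts K) f"] conjI ballI)
    show "bij_betw (inv_into (verts K) f) (verts H) (verts K)"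
      using assms(2) by (simp add: H_def bij_betw_inv_into bij_betw_def inj_on_inv_into)
    fix x y assume "x \<in> verts H" "y \<in> verts H"
    then obtain x' y' where xy: "x' \<in> verts K" "y' \<in> verts K" "x = f x'" "y = f y'"
      by (auto simp: H_def)
    have "{x, y} = f ` {x', y'}" using xy by simp
    hence "{x, y} \<in> edges H \<longleftrightarrow> (\<exists>e\<in>edges K. f ` {x', y'} = f ` e)"
      by (auto simp: H_def)
    also have "\<dots> \<longleftrightarrow> {x', y'} \<in> edges K"
      using inj_on_image_eq_iff[OF assms(2)] K(2) xy by (metis empty_subsetI insert_subset)
    finally show "{x, y} \<in> edges H \<longleftrightarrow>
        {inv_into (verts K) f x, inv_into (verts K) f y} \<in> edges K"
      using xy assms(2) by simp
  qed
  ultimately show ?thesis by blast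
qed

section \<open>The numerical estimates and the conclusion\<close>

theorem theorem2:
  fixes r n :: nat and c :: real and G :: "'a graph"
  assumes "r \<ge> 2"
    and "c = real r powi (- int ((r + 7) * (r + 1)))"
    and "real n \<ge> exp (2 / c)"
    and "sgraph G"
    and "card (verts G) = n"
    and "card (edges G) = turan_number r n + 1"
  shows "\<exists>H. subgraph H G \<and>
           isomorphic H (complete_multipartite_plus (replicate r (nat \<lfloor>c * ln (real n)\<rfloor>)))"
proof -
  define P where "P = r ^ ((r + 7) * (r + 1))"
  define s where "s = nat \<lfloor>c * ln (real n)\<rfloor>"
  define S where "S = (8 * r) ^ r * s"
  have "P > 0" using assms(1) by (simp add: P_def)
  have c: "c = 1 / real P" unfolding assms(2) P_def power_int_minus power_int_of_nat of_nat_power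
    by (rule inverse_eq_divide)
  hence "c > 0" using \<open>P > 0\<close> by simp
  have "n > 0" using less_le_trans[OF exp_gt_zero assms(3)] by simp
  have "2 / c \<le> ln (real n)" using assms(3) \<open>n > 0\<close> by (simp add: ln_ge_iff)
  hence cln: "2 \<le> c * ln (real n)" using \<open>c > 0\<close> by (simp add: field_simps)
  hence s2: "s \<ge> 2" unfolding s_def by linarith
  have s_le: "real s \<le> c * ln (real n)" unfolding s_def using cln by linarith
  \<comment> \<open>The 6 comes from \<open>(8 ^ S)\<^sup>2 = 2 ^ (6 * S)\<close>, squared because
    the dense subset may have only about \<open>sqrt n\<close> vertices. As \<open>6\<close> and
    \<open>8\<close> are at most \<open>r ^ 3\<close>, an exponent of \<open>3 + 4 * r\<close>
    suffices.\<close>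
  have "6 * (8 * r) ^ r \<le> P"
  proof -
    have "(6::nat) \<le> 2 ^ 3" by simp
    also have "\<dots> \<le> r ^ 3" using assms(1) by (intro power_mono) auto
    finally have r3: "6 \<le> r ^ 3" .
    have "(8::nat) = 2 ^ 3" by simp
    also have "\<dots> \<le> r ^ 3" using assms(1) by (intro power_mono) auto
    finally have "8 * r \<le> r ^ 3 * r" by (intro mult_le_mono1)
    hence "(8 * r) ^ r \<le> (r ^ 4) ^ r" by (intro power_mono) (simp_all add: eval_nat_numeral mult_ac)
    hence "6 * (8 * r) ^ r \<le> r ^ 3 * (r ^ 4) ^ r" using r3 by (intro mult_le_mono)
    also have "\<dots> = r ^ (3 + 4 * r)" by (simp add: power_add power_mult)
    also have "\<dots> \<le> P" unfolding P_def using assms(1)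
      by (intro power_increasing) (auto simp: algebra_simps)
    finally show ?thesis .
  qed
  hence "real (6 * (8 * r) ^ r) * c \<le> 1"
    using \<open>P > 0\<close> unfolding c by (simp add: field_simps del: of_nat_mult of_nat_power)
  hence "real (6 * (8 * r) ^ r) * c * ln (real n) \<le> 1 * ln (real n)"
    using \<open>n > 0\<close> by (intro mult_right_mono) auto
  moreover have "real (6 * S) \<le> real (6 * (8 * r) ^ r) * (c * ln (real n))"
    using mult_left_mono[OF s_le, of "real (6 * (8 * r) ^ r)"] by (simp add: S_def mult_ac)
  ultimately have S: "real (6 * S) \<le> ln (real n)" by (simp add: mult.assoc)
  have "real ((8 ^ S)\<^sup>2) = 2 ^ (6 * S)"
    by (simp add: power_mult[symmetric] mult.commute[of S]) (simp add: power_mult)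
  also have "\<dots> \<le> exp 1 ^ (6 * S)"
    using exp_ge_add_one_self[of 1] by (intro power_mono) auto
  also have "\<dots> = exp (real (6 * S))" by (simp add: exp_of_nat_mult[symmetric])
  also have "\<dots> \<le> real n" using S \<open>n > 0\<close> by (simp add: ln_ge_iff)
  finally have nS: "(8 ^ S)\<^sup>2 \<le> n" by (simp only: of_nat_le_iff)

  interpret edge_set "edges G"
    using assms(4) by unfold_locales (auto simp: sgraph_def)
  have fin: "finite (verts G)" using assms(4) by (simp add: sgraph_def)
  have ind: "induced (verts G) = edges G"
    using assms(4) by (auto simp: induced_def sgraph_def)
  have "r > 0" using assms(1) by simp
  have le: "card (verts G) \<le> n" using assms(5) by simp
  \<comment> \<open>With \<open>N = n\<close> the initial excess condition is just the one edge
    beyond the Turan number.\<close>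
  have "turan_number r (card (verts G)) + n < card (induced (verts G)) + card (verts G)"
    by (simp add: ind assms(5,6))
  from large_min_degree_subset[OF fin \<open>r > 0\<close> le this]
  obtain U where U: "U \<subseteq> verts G" "n \<le> card U * card U"
    "turan_number r (card U) < card (induced U)"
    and deg: "\<forall>v\<in>U. card U \<le> card (nb U v) + (card U div r + 1)"
    by (elim exE conjE)
  have "(8 ^ S)\<^sup>2 \<le> (card U)\<^sup>2" using nS U(2) by (simp add: power2_eq_square)
  hence "8 ^ ((8 * r) ^ r * s) \<le> card U"
    unfolding S_def[symmetric] by (rule power2_le_imp_le) simp
  from complete_multipartite_plus_embedding[OF finite_subset[OF U(1) fin] assms(1) U(3)
      deg s2 this]
  obtain f where f: "inj_on f (verts (complete_multipartite_plus (replicate r s)))"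
    "f ` verts (complete_multipartite_plus (replicate r s)) \<subseteq> U"
    "\<forall>e\<in>edges (complete_multipartite_plus (replicate r s)). f ` e \<in> edges G"
    by (elim exE conjE)
  have sg: "sgraph (complete_multipartite_plus (replicate r s))"
    using assms(1) s2 by (intro sgraph_complete_multipartite_plus) (auto simp: hd_replicate)
  show ?thesis
    unfolding s_def[symmetric]
    by (rule subgraph_of_embedding[OF sg f(1) order_trans[OF f(2) U(1)] f(3)])
qed

end
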